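(* Every locally compact separable metric space has a strongly proper dyadic subbase.
   Context: Let $X$ be a second-countable Hausdorff space with family of open sets $\mathfrak{O}$, and let $\omega$ be the set of natural numbers. A dyadic subbase of $X$ is a map $S:\omega\times\{0,1\}\to\mathfrak{O}$, written $S_n^a:=S(n,a)$, such that (1) $\{S_n^a : n<\omega,\ a\in\{0,1\}\}$ is a subbase of $X$, and (2) $S_n^0\cap S_n^1=\emptyset$ for all $n<\omega$. Put $S_n^{\partial}:=X\setminus(S_n^0\cup S_n^1)$. Let $\bot$ be a symbol meaning "undefined". For a finite set $\Sigma$ containing $\bot$ and a sequence $\sigma:\omega\to\Sigma$, put $\operatorname{dom}(\sigma):=\{k:\sigma(k)\neq\bot\}$; $\Sigma^*$ denotes the set of sequences $\sigma:\omega\to\Sigma$ with $\operatorname{dom}(\sigma)$ finite. For $\sigma\in\{0,1,\partial,\bot\}^*$ put $$S(\sigma):=\bigcap_{k\in\operatorname{dom}(\sigma)}S_k^{\sigma(k)},\qquad \bar S(\sigma):=\bigcap_{k\in\operatorname{dom}(\sigma)}\left(S_k^{\sigma(k)}\cup S_k^{\partial}\right),$$ where an empty intersection is $X$. The dyadic subbase $S$ is strongly proper if $\bar S(\sigma)=\operatorname{cl}S(\sigma)$ for all $\sigma\in\{0,1,\partial,\bot\}^*$, where $\operatorname{cl}$ denotes closure in $X$. *)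

theory Defs
  imports "HOL-Analysis.Analysis"
begin

text \<open>The digits 0 and 1 are the booleans \<open>False\<close> and \<open>True\<close>, so that a map
  from \<open>\<omega> \<times> {0, 1}\<close> to sets is a curried function \<open>S :: nat \<Rightarrow> bool \<Rightarrow> 'a set\<close>.
  The empty intersection of members of a subbase is the whole space, hence
  \<open>relative_to topspace X\<close>; the subbase itself need not cover the space.\<close>

definition dyadic_subbase :: "'a topology \<Rightarrow> (nat \<Rightarrow> bool \<Rightarrow> 'a set) \<Rightarrow> bool" where
  "dyadic_subbase X S \<longleftrightarrow>
     (\<forall>n a. openin X (S n a)) \<and>
     openin X = arbitrary union_of
       (finite intersection_of (\<lambda>U. U \<in> {S n a | n a. True}) relative_to topspace X) \<and>
     (\<forall>n. S n False \<inter> S n True = {})"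

definition dyadic_bdry :: "'a topology \<Rightarrow> (nat \<Rightarrow> bool \<Rightarrow> 'a set) \<Rightarrow> nat \<Rightarrow> 'a set" where
  "dyadic_bdry X S n = topspace X - (S n False \<union> S n True)"

text \<open>A sequence over \<open>{0, 1, \<partial>, \<bottom>}\<close> is a partial map \<open>\<sigma> :: nat \<rightharpoonup> letter\<close>, where \<open>\<bottom>\<close> is
  \<open>None\<close>; it belongs to \<open>{0, 1, \<partial>, \<bottom>}\<^sup>*\<close> iff \<open>finite (dom \<sigma>)\<close>.\<close>

datatype letter = Digit bool | Bdry

fun dyadic_letter :: "'a topology \<Rightarrow> (nat \<Rightarrow> bool \<Rightarrow> 'a set) \<Rightarrow> nat \<Rightarrow> letter \<Rightarrow> 'a set" where
  "dyadic_letter X S n (Digit a) = S n a"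
| "dyadic_letter X S n Bdry = dyadic_bdry X S n"

text \<open>Intersecting with \<open>topspace X\<close> makes the value at the empty sequence the whole space.\<close>

definition dyadic_cell :: "'a topology \<Rightarrow> (nat \<Rightarrow> bool \<Rightarrow> 'a set) \<Rightarrow> (nat \<rightharpoonup> letter) \<Rightarrow> 'a set" where
  "dyadic_cell X S \<sigma> = topspace X \<inter> (\<Inter>k\<in>dom \<sigma>. dyadic_letter X S k (the (\<sigma> k)))"

definition dyadic_closed_cell :: "'a topology \<Rightarrow> (nat \<Rightarrow> bool \<Rightarrow> 'a set) \<Rightarrow> (nat \<rightharpoonup> letter) \<Rightarrow> 'a set" where
  "dyadic_closed_cell X S \<sigma> =
     topspace X \<inter> (\<Inter>k\<in>dom \<sigma>. dyadic_letter X S k (the (\<sigma> k)) \<union> dyadic_bdry X S k)"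

definition strongly_proper :: "'a topology \<Rightarrow> (nat \<Rightarrow> bool \<Rightarrow> 'a set) \<Rightarrow> bool" where
  "strongly_proper X S \<longleftrightarrow>
     (\<forall>\<sigma>. finite (dom \<sigma>) \<longrightarrow> dyadic_closed_cell X S \<sigma> = X closure_of (dyadic_cell X S \<sigma>))"

end

theory Submission
  imports Defs
begin

text \<open>The digit sets are sought in the form \<open>S\<^sub>n\<^sup>0 = {f\<^sub>n < \<theta>\<^sub>n}\<close> and \<open>S\<^sub>n\<^sup>1 = {f\<^sub>n > \<theta>\<^sub>n}\<close>, where
  \<open>f\<^sub>0, f\<^sub>1, \<dots>\<close> are countably many Urysohn functions which separate points from closed
  sets. Such sets form a subbase for every choice of levels \<open>\<theta>\<^sub>n\<close> strictly between the two extreme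
  values (\<open>dyadic_subbase_half_space\<close>), so the levels may be chosen generically.

  Strong properness is a local condition. If \<open>x\<close> lies in the closed cell of \<open>\<sigma>\<close>, then the
  letters of \<open>\<sigma>\<close> at the indices with \<open>f\<^sub>k x \<noteq> \<theta>\<^sub>k\<close> hold on a whole neighbourhood of \<open>x\<close>, so it
  remains to find, arbitrarily close to \<open>x\<close>, points at which finitely many differences
  \<open>f\<^sub>k - \<theta>\<^sub>k\<close>, all vanishing at \<open>x\<close>, have prescribed signs in \<open>{-1, 0, 1}\<close>. Levels for which this
  is always possible are called transversal below; they make the subbase strongly proper
  (\<open>strongly_proper_half_space\<close>).

  That transversal levels exist (\<open>generic_levels_transversal\<close>) is a Baire category argument in the
  space of all sequences \<open>c\<close> of reals, with \<open>\<theta>\<^sub>k = arctan c\<^sub>k\<close>. For a compact set \<open>K\<close> and a finite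
  set \<open>F\<close> of indices, let \<open>E K F\<close> be the set of those \<open>c\<close> for which some \<open>x \<in> K\<close> solves
  \<open>f\<^sub>k x = arctan c\<^sub>k\<close> for all \<open>k \<in> F\<close>. It is closed, hence its frontier is closed and nowhere dense.
  As \<open>X\<close> is locally compact and second countable, there are countably many compact sets among which
  every neighbourhood of every point \<open>x\<close> contains one through \<open>x\<close>. With \<open>K\<close> ranging over these,
  only countably many frontiers arise, and some \<open>c\<close> avoids all of them. Now if
  \<open>x \<in> K\<close> lies on the levels given by \<open>c\<close>, then \<open>c \<in> E K F\<close>, hence \<open>c\<close> is an interior point, and
  \<open>c + t v \<in> E K F\<close> for every direction \<open>v\<close> and all small \<open>t > 0\<close>. This says that \<open>K\<close> contains a
  point \<open>y\<close> such that \<open>f\<^sub>k y - \<theta>\<^sub>k\<close> has the sign of \<open>v\<^sub>k\<close> for every \<open>k \<in> F\<close>.\<close>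

section \<open>Half spaces and transversal levels\<close>

definition half_space ::
    "'a topology \<Rightarrow> (nat \<Rightarrow> 'a \<Rightarrow> real) \<Rightarrow> (nat \<Rightarrow> real) \<Rightarrow> nat \<Rightarrow> bool \<Rightarrow> 'a set" where
  "half_space X f \<theta> n a = {x \<in> topspace X. if a then \<theta> n < f n x else f n x < \<theta> n}"

text \<open>Wherever finitely many of the functions attain their levels simultaneously, every
  combination of the signs of \<open>f k - \<theta> k\<close> occurs arbitrarily close by. The sign pattern is given by
  the signs of an arbitrary real vector, which later serves as a direction of perturbation.\<close>

definition transversal_levels ::
    "'a topology \<Rightarrow> (nat \<Rightarrow> 'a \<Rightarrow> real) \<Rightarrow> (nat \<Rightarrow> real) \<Rightarrow> bool" where
  "transversal_levels X f \<theta> \<longleftrightarrow>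
     (\<forall>F U x. finite F \<longrightarrow> openin X U \<longrightarrow> x \<in> U \<longrightarrow> (\<forall>k\<in>F. f k x = \<theta> k) \<longrightarrow>
        (\<forall>v::nat \<Rightarrow> real. \<exists>y\<in>U. \<forall>k\<in>F. sgn (f k y - \<theta> k) = sgn (v k)))"

section \<open>Generic levels\<close>

text \<open>The set is the preimage, under a continuous map of \<open>c\<close>, of the compact image of \<open>K\<close> under
  the coordinates \<open>f\<^sub>k\<close>, \<open>k \<in> F\<close>; the coordinates outside \<open>F\<close> are replaced by \<open>0\<close> on both sides.\<close>

lemma closed_simultaneous_levels:
  fixes f :: "nat \<Rightarrow> 'a \<Rightarrow> real" and g :: "real \<Rightarrow> real"
  assumes f: "\<And>k. continuous_map X euclideanreal (f k)"
    and g: "continuous_on UNIV g" and K: "compactin X K"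
  shows "closed {c :: nat \<Rightarrow> real. \<exists>x\<in>K. \<forall>k\<in>F. f k x = g (c k)}"
proof -
  define \<Phi> :: "'a \<Rightarrow> nat \<Rightarrow> real" where "\<Phi> = (\<lambda>x k. if k \<in> F then f k x else 0)"
  define \<Gamma> :: "(nat \<Rightarrow> real) \<Rightarrow> nat \<Rightarrow> real" where "\<Gamma> = (\<lambda>c k. if k \<in> F then g (c k) else 0)"
  have "continuous_map X euclidean \<Phi>"
    unfolding euclidean_product_topology[symmetric] continuous_map_componentwise_UNIV \<Phi>_def
    using f by auto
  then have "compactin euclidean (\<Phi> ` K)"
    using K image_compactin by blast
  then have "closed (\<Phi> ` K)"
    by (simp add: compact_imp_closed)
  moreover have "continuous_on UNIV \<Gamma>"
  proof (rule continuous_on_coordinatewise_then_product)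
    fix k
    have "continuous_on UNIV (\<lambda>c::nat \<Rightarrow> real. g (c k))"
      by (rule continuous_on_compose2[OF g continuous_on_product_coordinates]) auto
    then show "continuous_on UNIV (\<lambda>c. \<Gamma> c k)"
      by (cases "k \<in> F") (simp_all add: \<Gamma>_def)
  qed
  ultimately have "closed (\<Gamma> -` (\<Phi> ` K))"
    using continuous_closed_vimage[of "\<Phi> ` K" \<Gamma>] by (simp add: continuous_on_eq_continuous_at)
  moreover have "\<Gamma> -` (\<Phi> ` K) = {c. \<exists>x\<in>K. \<forall>k\<in>F. f k x = g (c k)}"
  proof -
    have "\<Gamma> c = \<Phi> x \<longleftrightarrow> (\<forall>k\<in>F. f k x = g (c k))" for c x
      by (auto simp: \<Phi>_def \<Gamma>_def fun_eq_iff)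
    then show ?thesis
      by (auto simp: image_iff)
  qed
  ultimately show ?thesis
    by simp
qed

text \<open>The frontier \<open>E - interior E\<close> of a closed set is closed with empty interior, and by Baire's
  theorem countably many such sets do not cover a complete space.\<close>

lemma avoid_countably_many_frontiers:
  fixes E :: "'i \<Rightarrow> 'b::complete_space set"
  assumes "countable I" and "\<And>i. i \<in> I \<Longrightarrow> closed (E i)"
  obtains c where "\<And>i. i \<in> I \<Longrightarrow> c \<in> E i \<Longrightarrow> c \<in> interior (E i)"
proof -
  have "euclidean interior_of \<Union>((\<lambda>i. E i - interior (E i)) ` I) = ({} :: 'b set)"
  proof (rule Baire_category_alt)
    fix T assume "T \<in> (\<lambda>i. E i - interior (E i)) ` I"
    then obtain i where i: "i \<in> I" and T: "T = E i - interior (E i)"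
      by blast
    have "interior T \<subseteq> interior (E i)"
      unfolding T by (intro interior_mono) auto
    moreover have "interior T \<inter> interior (E i) = {}"
      using interior_subset[of T] unfolding T by blast
    ultimately have "interior T = {}"
      by blast
    moreover have "closed T"
      unfolding T using assms(2)[OF i] by (simp add: closed_Diff)
    ultimately show "closedin euclidean T \<and> euclidean interior_of T = {}"
      by simp
  qed (use assms(1) completely_metrizable_space_euclidean in auto)
  then have "\<Union>((\<lambda>i. E i - interior (E i)) ` I) \<noteq> UNIV"
    by auto
  then show ?thesis
    using that by blast
qed

text \<open>Those closures of members of a countable base that are compact.\<close>

lemma countable_compact_network:
  assumes "second_countable X" "locally_compact_space X" "Hausdorff_space X"
  obtains \<K> where "countable \<K>" "\<And>K. K \<in> \<K> \<Longrightarrow> compactin X K"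
    "\<And>U x. openin X U \<Longrightarrow> x \<in> U \<Longrightarrow> \<exists>K\<in>\<K>. x \<in> K \<and> K \<subseteq> U"
proof -
  obtain \<B> where \<B>: "countable \<B>" "\<And>V. V \<in> \<B> \<Longrightarrow> openin X V"
    "\<And>U x. openin X U \<Longrightarrow> x \<in> U \<Longrightarrow> \<exists>V\<in>\<B>. x \<in> V \<and> V \<subseteq> U"
    using assms(1) by (auto simp: second_countable_def)
  define \<K> where "\<K> = {K \<in> (\<lambda>V. X closure_of V) ` \<B>. compactin X K}"
  show thesis
  proof
    show "countable \<K>"
      unfolding \<K>_def using \<B>(1) by (auto intro: countable_subset[of _ "(\<lambda>V. X closure_of V) ` \<B>"])
    show "compactin X K" if "K \<in> \<K>" for K
      using that by (simp add: \<K>_def)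
    fix U x assume "openin X U" "x \<in> U"
    moreover have "neighbourhood_base_of (compactin X) X"
      using assms locally_compact_space_neighbourhood_base by blast
    ultimately obtain W C where WC: "openin X W" "compactin X C" "x \<in> W" "W \<subseteq> C" "C \<subseteq> U"
      unfolding neighbourhood_base_of by meson
    obtain V where V: "V \<in> \<B>" "x \<in> V" "V \<subseteq> W"
      using \<B>(3) WC by blast
    have sub: "X closure_of V \<subseteq> C"
      using V WC assms(3) by (meson closure_of_minimal compactin_imp_closedin order_trans)
    then have "compactin X (X closure_of V)"
      using WC closed_compactin closedin_closure_of by blast
    moreover have "x \<in> X closure_of V"
      using V \<B>(2) by (meson closure_of_subset openin_subset subsetD)
    ultimately show "\<exists>K\<in>\<K>. x \<in> K \<and> K \<subseteq> U"
      using V sub WC unfolding \<K>_def by blast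
  qed
qed

text \<open>The map \<open>arctan\<close> serves to keep the levels in a bounded interval while the parameters range
  over the complete space of all real sequences. Its continuity makes the sets of parameters closed,
  and its strict monotonicity turns the direction of a perturbation of the parameters into the signs
  of \<open>f k y - \<theta> k\<close>.\<close>

lemma generic_levels_transversal:
  fixes f :: "nat \<Rightarrow> 'a \<Rightarrow> real"
  assumes "second_countable X" "locally_compact_space X" "Hausdorff_space X"
    and f: "\<And>k. continuous_map X euclideanreal (f k)"
  obtains \<theta> where "\<And>k. -(pi/2) < \<theta> k" "\<And>k. \<theta> k < pi/2" "transversal_levels X f \<theta>"
proof -
  obtain \<K> where \<K>: "countable \<K>" "\<And>K. K \<in> \<K> \<Longrightarrow> compactin X K"
    "\<And>U x. openin X U \<Longrightarrow> x \<in> U \<Longrightarrow> \<exists>K\<in>\<K>. x \<in> K \<and> K \<subseteq> U"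
    using countable_compact_network[OF assms(1-3)] by blast
  define E :: "'a set \<times> nat set \<Rightarrow> (nat \<Rightarrow> real) set"
    where "E = (\<lambda>(K, F). {c. \<exists>x\<in>K. \<forall>k\<in>F. f k x = arctan (c k)})"
  have "countable (\<K> \<times> {F::nat set. finite F})"
    using \<K>(1) countable_Collect_finite by blast
  moreover have "closed (E i)" if "i \<in> \<K> \<times> {F. finite F}" for i
    using that \<K>(2) closed_simultaneous_levels[of X f arctan, OF f] continuous_on_arctan[OF continuous_on_id]
    by (auto simp: E_def)
  ultimately obtain c
    where c: "\<And>i. i \<in> \<K> \<times> {F. finite F} \<Longrightarrow> c \<in> E i \<Longrightarrow> c \<in> interior (E i)"
    using avoid_countably_many_frontiers[of "\<K> \<times> {F. finite F}" E] by blast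
  have "transversal_levels X f (\<lambda>k. arctan (c k))"
    unfolding transversal_levels_def
  proof (intro allI impI)
    fix F U x and v :: "nat \<Rightarrow> real"
    assume F: "finite F" and U: "openin X U" "x \<in> U" and x: "\<forall>k\<in>F. f k x = arctan (c k)"
    obtain K where K: "K \<in> \<K>" "x \<in> K" "K \<subseteq> U"
      using \<K>(3) U by blast
    have int: "c \<in> interior (E (K, F))"
      using c[of "(K, F)"] K F x by (auto simp: E_def)
    \<comment> \<open>As \<open>c\<close> is interior, this line stays in \<open>E (K, F)\<close> for small \<open>t > 0\<close>, and a point of \<open>K\<close>
      that witnesses this has the desired signs.\<close>
    define \<gamma> :: "real \<Rightarrow> nat \<Rightarrow> real" where "\<gamma> = (\<lambda>t k. c k + t * v k)"
    have "continuous_on UNIV \<gamma>"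
      unfolding \<gamma>_def by (intro continuous_on_coordinatewise_then_product continuous_intros)
    then have "open (\<gamma> -` interior (E (K, F)))"
      by (intro open_vimage) auto
    moreover have "0 \<in> \<gamma> -` interior (E (K, F))"
      using int by (simp add: \<gamma>_def)
    ultimately obtain e where e: "e > 0" "\<And>t. dist t 0 < e \<Longrightarrow> \<gamma> t \<in> interior (E (K, F))"
      unfolding open_dist by (metis vimageD)
    define t where "t = e / 2"
    have t: "t > 0" "\<gamma> t \<in> E (K, F)"
      using e interior_subset[of "E (K, F)"] by (auto simp: t_def)
    then obtain y where y: "y \<in> K" "\<forall>k\<in>F. f k y = arctan (c k + t * v k)"
      by (auto simp: E_def \<gamma>_def)
    have "sgn (arctan (c k + t * v k) - arctan (c k)) = sgn (v k)" for k
    proof (cases "v k" "0::real" rule: linorder_cases)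
      case less
      then have "t * v k < 0"
        using t(1) by (simp add: mult_pos_neg)
      then show ?thesis
        using less arctan_monotone[of "c k + t * v k" "c k"] by simp
    next
      case greater
      then have "t * v k > 0"
        using t(1) by simp
      then show ?thesis
        using greater arctan_monotone[of "c k" "c k + t * v k"] by simp
    qed simp
    then show "\<exists>y\<in>U. \<forall>k\<in>F. sgn (f k y - arctan (c k)) = sgn (v k)"
      using y K(3) by (metis subsetD)
  qed
  then show thesis
    using that[of "\<lambda>k. arctan (c k)"] arctan_bounded by simp
qed

section \<open>Transversality gives strong properness\<close>

lemma openin_half_space:
  assumes "continuous_map X euclideanreal (f n)"
  shows "openin X (half_space X f \<theta> n a)"
proof -
  have "openin X {x \<in> topspace X. f n x \<in> (if a then {\<theta> n<..} else {..<\<theta> n})}"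
    using assms by (intro openin_continuous_map_preimage) auto
  then show ?thesis
    by (cases a) (simp_all add: half_space_def)
qed

lemma dyadic_bdry_half_space:
  "dyadic_bdry X (half_space X f \<theta>) n = {x \<in> topspace X. f n x = \<theta> n}"
  by (auto simp: dyadic_bdry_def half_space_def)

text \<open>Adding the boundary to the set of a digit gives the complement of the set of the opposite
  digit.\<close>

lemma closedin_dyadic_closed_cell:
  assumes S: "\<And>n a. openin X (S n a)" and disj: "\<And>n. S n False \<inter> S n True = {}"
  shows "closedin X (dyadic_closed_cell X S \<sigma>)"
proof -
  have "closedin X (dyadic_letter X S k l \<union> dyadic_bdry X S k)" for k l
  proof (cases l)
    case (Digit a)
    have "S k a \<subseteq> topspace X"
      using S openin_subset by blast
    then have "dyadic_letter X S k l \<union> dyadic_bdry X S k = topspace X - S k (\<not> a)"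
      using Digit disj[of k] by (cases a) (auto simp: dyadic_bdry_def)
    then show ?thesis
      using S by auto
  next
    case Bdry
    have "openin X (S k False \<union> S k True)"
      using S by (intro openin_Un)
    then show ?thesis
      using Bdry by (simp add: dyadic_bdry_def closedin_diff)
  qed
  then show ?thesis
    unfolding dyadic_closed_cell_def
    by (cases "dom \<sigma> = {}") (auto intro!: closedin_Int closedin_INT)
qed

fun letter_sign :: "letter \<Rightarrow> real" where
  "letter_sign (Digit a) = (if a then 1 else -1)"
| "letter_sign Bdry = 0"

lemma dyadic_letter_half_space:
  "dyadic_letter X (half_space X f \<theta>) k l =
     {x \<in> topspace X. sgn (f k x - \<theta> k) = sgn (letter_sign l)}"
  by (cases l) (auto simp: half_space_def dyadic_bdry_half_space sgn_if)

lemma strongly_proper_half_space: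
  assumes f: "\<And>n. continuous_map X euclideanreal (f n)"
    and trans: "transversal_levels X f \<theta>"
  shows "strongly_proper X (half_space X f \<theta>)"
  unfolding strongly_proper_def
proof (intro allI impI)
  fix \<sigma> :: "nat \<rightharpoonup> letter" assume fin: "finite (dom \<sigma>)"
  let ?S = "half_space X f \<theta>"
  let ?L = "\<lambda>k. dyadic_letter X ?S k (the (\<sigma> k))"
  note opn = openin_half_space[of X f, OF f]
  show "dyadic_closed_cell X ?S \<sigma> = X closure_of (dyadic_cell X ?S \<sigma>)"
  proof
    have "closedin X (dyadic_closed_cell X ?S \<sigma>)"
      by (rule closedin_dyadic_closed_cell[OF opn]) (auto simp: half_space_def)
    moreover have "dyadic_cell X ?S \<sigma> \<subseteq> dyadic_closed_cell X ?S \<sigma>"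
      by (auto simp: dyadic_cell_def dyadic_closed_cell_def)
    ultimately show "X closure_of (dyadic_cell X ?S \<sigma>) \<subseteq> dyadic_closed_cell X ?S \<sigma>"
      by (rule closure_of_minimal[rotated])
    show "dyadic_closed_cell X ?S \<sigma> \<subseteq> X closure_of (dyadic_cell X ?S \<sigma>)"
    proof
      fix x assume x: "x \<in> dyadic_closed_cell X ?S \<sigma>"
      then have xX: "x \<in> topspace X"
        and xL: "\<And>k. k \<in> dom \<sigma> \<Longrightarrow> x \<in> ?L k \<or> f k x = \<theta> k"
        by (auto simp: dyadic_closed_cell_def dyadic_bdry_half_space)
      \<comment> \<open>Off \<open>F\<close> the letters of \<open>\<sigma>\<close> are digits, an open condition; on \<open>F\<close> transversality is used.\<close>
      define F where "F = {k \<in> dom \<sigma>. f k x = \<theta> k}"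
      have openL: "openin X (?L k)" if "k \<in> dom \<sigma> - F" for k
      proof (cases "the (\<sigma> k)")
        case (Digit a)
        then show ?thesis
          using opn by simp
      next
        case Bdry
        then show ?thesis
          using that xL[of k] by (auto simp: F_def dyadic_bdry_half_space)
      qed
      show "x \<in> X closure_of (dyadic_cell X ?S \<sigma>)"
        unfolding in_closure_of
      proof (intro conjI xX allI impI)
        fix T assume T: "x \<in> T \<and> openin X T"
        define U where "U = T \<inter> ((\<Inter>k\<in>dom \<sigma> - F. ?L k) \<inter> topspace X)"
        have "openin X U"
          unfolding U_def using T fin openL by (intro openin_Int openin_INT) auto
        moreover have "x \<in> U"
          using T xX xL by (auto simp: U_def F_def)
        moreover have "finite F" "\<forall>k\<in>F. f k x = \<theta> k"
          using fin by (auto simp: F_def)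
        ultimately obtain y where y: "y \<in> U"
          "\<forall>k\<in>F. sgn (f k y - \<theta> k) = sgn (letter_sign (the (\<sigma> k)))"
          using trans[unfolded transversal_levels_def, rule_format,
              where v = "\<lambda>k. letter_sign (the (\<sigma> k))"] by blast
        have "y \<in> ?L k" if "k \<in> dom \<sigma>" for k
          using that y by (cases "k \<in> F") (auto simp: U_def dyadic_letter_half_space)
        then have "y \<in> dyadic_cell X ?S \<sigma>"
          using y by (auto simp: dyadic_cell_def U_def)
        then show "\<exists>y. y \<in> dyadic_cell X ?S \<sigma> \<and> y \<in> T"
          using y by (auto simp: U_def)
      qed
    qed
  qed
qed

section \<open>A separating sequence of functions\<close>

text \<open>Urysohn functions for the pairs \<open>(V, W)\<close> of basic open sets with \<open>cl V \<subseteq> W\<close>: by regularity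
  these pairs separate any point from the complement of any of its neighbourhoods, and there are
  only countably many of them.\<close>

lemma separating_functions:
  fixes a b :: real
  assumes "second_countable X" "normal_space X" "regular_space X"
  obtains f :: "nat \<Rightarrow> 'a \<Rightarrow> real"
  where "\<And>n. continuous_map X euclideanreal (f n)"
    "\<And>U x. openin X U \<Longrightarrow> x \<in> U \<Longrightarrow> \<exists>n. f n x = a \<and> (\<forall>y \<in> topspace X - U. f n y = b)"
proof -
  obtain \<B> where \<B>: "countable \<B>" "\<And>V. V \<in> \<B> \<Longrightarrow> openin X V"
    "\<And>U x. openin X U \<Longrightarrow> x \<in> U \<Longrightarrow> \<exists>V\<in>\<B>. x \<in> V \<and> V \<subseteq> U"
    using assms(1) by (auto simp: second_countable_def)
  \<comment> \<open>The empty set is added so that \<open>P\<close> is nonempty and can be enumerated by \<open>nat\<close>,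
    even if \<open>X\<close> is empty or \<open>P\<close> is finite.\<close>
  define P where "P = {(V, W) \<in> insert {} \<B> \<times> insert {} \<B>. X closure_of V \<subseteq> W}"
  have "countable P"
    by (rule countable_subset[of _ "insert {} \<B> \<times> insert {} \<B>"]) (use \<B>(1) in \<open>auto simp: P_def\<close>)
  moreover have "({}, {}) \<in> P"
    by (simp add: P_def)
  then have "P \<noteq> {}"
    by blast
  ultimately have ran: "range (from_nat_into P) = P"
    by (simp add: range_from_nat_into)
  have "\<exists>h. continuous_map X euclideanreal h \<and>
          (\<forall>x \<in> X closure_of fst p. h x = a) \<and> (\<forall>y \<in> topspace X - snd p. h y = b)"
    if "p \<in> P" for p
  proof -
    have "closedin X (topspace X - snd p)" "disjnt (X closure_of fst p) (topspace X - snd p)"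
      using that \<B>(2) by (auto simp: P_def disjnt_iff)
    then obtain h where "continuous_map X euclideanreal h"
      "h ` (X closure_of fst p) \<subseteq> {a}" "h ` (topspace X - snd p) \<subseteq> {b}"
      by (rule Urysohn_lemma_alt[OF assms(2) closedin_closure_of])
    then show ?thesis
      by (intro exI[of _ h]) auto
  qed
  then obtain h where h: "\<And>p. p \<in> P \<Longrightarrow> continuous_map X euclideanreal (h p)"
    "\<And>p x. p \<in> P \<Longrightarrow> x \<in> X closure_of fst p \<Longrightarrow> h p x = a"
    "\<And>p y. p \<in> P \<Longrightarrow> y \<in> topspace X - snd p \<Longrightarrow> h p y = b"
    by metis
  show thesis
  proof
    show "continuous_map X euclideanreal (h (from_nat_into P n))" for n
      using h(1) ran by blast
    fix U x assume U: "openin X U" "x \<in> U"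
    then obtain W where W: "W \<in> \<B>" "x \<in> W" "W \<subseteq> U"
      using \<B>(3) by blast
    have "neighbourhood_base_of (closedin X) X"
      using assms(3) neighbourhood_base_of_closedin by blast
    then obtain V' C where C: "openin X V'" "closedin X C" "x \<in> V'" "V' \<subseteq> C" "C \<subseteq> W"
      using \<B>(2)[OF W(1)] W(2) unfolding neighbourhood_base_of by meson
    then obtain V where V: "V \<in> \<B>" "x \<in> V" "V \<subseteq> V'"
      using \<B>(3)[OF C(1) C(3)] by blast
    have "X closure_of V \<subseteq> W"
      using V C by (meson closure_of_minimal order_trans)
    then have P: "(V, W) \<in> P"
      using V W by (auto simp: P_def)
    then obtain n where n: "from_nat_into P n = (V, W)"
      using ran by (metis rangeE)
    have "x \<in> X closure_of V"
      using V \<B>(2) by (meson closure_of_subset openin_subset subsetD)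
    then have "h (V, W) x = a" "\<forall>y \<in> topspace X - U. h (V, W) y = b"
      using h(2,3)[OF P] W by auto
    then show "\<exists>n. h (from_nat_into P n) x = a \<and>
        (\<forall>y \<in> topspace X - U. h (from_nat_into P n) y = b)"
      using n by metis
  qed
qed

lemma dyadic_subbase_half_space:
  assumes f: "\<And>n. continuous_map X euclideanreal (f n)"
    and sep: "\<And>U x. openin X U \<Longrightarrow> x \<in> U \<Longrightarrow>
                \<exists>n. f n x < \<theta> n \<and> (\<forall>y \<in> topspace X - U. \<theta> n < f n y)"
  shows "dyadic_subbase X (half_space X f \<theta>)"
proof -
  let ?S = "half_space X f \<theta>"
  let ?P = "\<lambda>U. U \<in> {?S n a | n a. True}"
  note opn = openin_half_space[of X f, OF f]
  have "openin X = arbitrary union_of (finite intersection_of ?P relative_to topspace X)"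
    unfolding openin_topology_base_unique
  proof (intro conjI allI impI)
    fix V assume "(finite intersection_of ?P relative_to topspace X) V"
    then obtain \<U> where "finite \<U>" "\<U> \<subseteq> {?S n a | n a. True}" "V = topspace X \<inter> \<Inter>\<U>"
      unfolding relative_to_def intersection_of_def by auto
    moreover from this have "\<And>U. U \<in> \<U> \<Longrightarrow> openin X U"
      using opn by blast
    ultimately show "openin X V"
      by (cases "\<U> = {}") (auto intro!: openin_Int openin_Inter)
  next
    fix U x assume U: "openin X U \<and> x \<in> U"
    then obtain n where n: "f n x < \<theta> n" "\<forall>y \<in> topspace X - U. \<theta> n < f n y"
      using sep by blast
    have "(finite intersection_of ?P) (?S n False)"
      unfolding intersection_of_def by (rule exI[of _ "{?S n False}"]) auto
    then have "(finite intersection_of ?P relative_to topspace X) (?S n False)"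
      unfolding relative_to_def
    proof (intro exI[of _ "?S n False"] conjI)
      show "topspace X \<inter> ?S n False = ?S n False"
        by (auto simp: half_space_def)
    qed
    moreover have "x \<in> ?S n False"
      using n U openin_subset by (fastforce simp: half_space_def)
    moreover have "?S n False \<subseteq> U"
    proof
      fix y assume y: "y \<in> ?S n False"
      show "y \<in> U"
      proof (rule ccontr)
        assume "y \<notin> U"
        then have "\<theta> n < f n y"
          using n(2) y by (simp add: half_space_def)
        then show False
          using y by (simp add: half_space_def)
      qed
    qed
    ultimately show "\<exists>V. (finite intersection_of ?P relative_to topspace X) V \<and> x \<in> V \<and> V \<subseteq> U"
      by blast
  qed
  then show ?thesis
    unfolding dyadic_subbase_def using opn by (auto simp: half_space_def)
qed

section \<open>Locally compact separable metric spaces\<close>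

lemma (in Metric_space) separable_imp_second_countable:
  assumes "separable_space mtopology"
  shows "second_countable mtopology"
proof -
  obtain D where D: "countable D" "D \<subseteq> M" "mtopology closure_of D = M"
    using assms unfolding separable_space_def by auto
  define \<B> where "\<B> = (\<lambda>(q, n). mball q (1 / Suc n)) ` (D \<times> (UNIV :: nat set))"
  have "\<exists>V\<in>\<B>. x \<in> V \<and> V \<subseteq> U" if "openin mtopology U" "x \<in> U" for U x
  proof -
    obtain r where r: "r > 0" "mball x r \<subseteq> U" and xM: "x \<in> M"
      using \<open>openin mtopology U\<close> \<open>x \<in> U\<close> unfolding openin_mtopology by blast
    obtain n where n: "1 / Suc n < r / 2"
      using reals_Archimedean[of "r / 2"] r by (auto simp: inverse_eq_divide)
    have "x \<in> mtopology closure_of D"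
      using D(3) xM by simp
    then obtain q where q: "q \<in> D" "q \<in> mball x (1 / Suc n)"
      unfolding metric_closure_of
      by (smt (verit) mem_Collect_eq of_nat_0_less_iff zero_less_Suc zero_less_divide_1_iff)
    have "mball q (1 / Suc n) \<subseteq> mball x r"
      using q n by (intro mball_subset) (auto simp: commute)
    moreover have "x \<in> mball q (1 / Suc n)"
      using q by (simp add: commute)
    ultimately show ?thesis
      using r q unfolding \<B>_def by blast
  qed
  moreover have "countable \<B>"
    unfolding \<B>_def using D(1) by auto
  ultimately show ?thesis
    unfolding second_countable_def by (intro exI[of _ \<B>]) (auto simp: \<B>_def)
qed

theorem theorem3p1:
  fixes M :: "'a set" and d :: "'a \<Rightarrow> 'a \<Rightarrow> real"
  assumes "Metric_space M d"
    and "locally_compact_space (Metric_space.mtopology M d)"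
    and "separable_space (Metric_space.mtopology M d)"
  shows "\<exists>S. dyadic_subbase (Metric_space.mtopology M d) S \<and>
             strongly_proper (Metric_space.mtopology M d) S"
proof -
  interpret Metric_space M d
    by (fact assms(1))
  have sc: "second_countable mtopology"
    using assms(3) by (rule separable_imp_second_countable)
  obtain f :: "nat \<Rightarrow> 'a \<Rightarrow> real"
    where f: "\<And>n. continuous_map mtopology euclideanreal (f n)"
      and sep: "\<And>U x. openin mtopology U \<Longrightarrow> x \<in> U \<Longrightarrow>
                  \<exists>n. f n x = -(pi/2) \<and> (\<forall>y \<in> topspace mtopology - U. f n y = pi/2)"
    using separating_functions[OF sc normal_space_mtopology regular_space_mtopology, of "-(pi/2)" "pi/2"]
    by auto
  obtain \<theta> where \<theta>: "\<And>k. -(pi/2) < \<theta> k" "\<And>k. \<theta> k < pi/2" "transversal_levels mtopology f \<theta>"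
    using generic_levels_transversal[OF sc assms(2) Hausdorff_space_mtopology, of f] f by blast
  have "dyadic_subbase mtopology (half_space mtopology f \<theta>)"
  proof (rule dyadic_subbase_half_space[of mtopology f, OF f])
    fix U x assume "openin mtopology U" "x \<in> U"
    then obtain n where "f n x = -(pi/2)" "\<forall>y \<in> topspace mtopology - U. f n y = pi/2"
      using sep by blast
    then have "f n x < \<theta> n \<and> (\<forall>y \<in> topspace mtopology - U. \<theta> n < f n y)"
      using \<theta>(1,2) by metis
    then show "\<exists>n. f n x < \<theta> n \<and> (\<forall>y \<in> topspace mtopology - U. \<theta> n < f n y)"
      by blast
  qed
  moreover have "strongly_proper mtopology (half_space mtopology f \<theta>)"
    using f \<theta>(3) by (rule strongly_proper_half_space)
  ultimately show ?thesis
    by blast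
qed

end
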